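(* There is an absolute constant $c>0$ such that for any $\epsilon>0$, if $\gamma\leq c\,\frac{\epsilon^2}{\log(n/\epsilon)}$, then with probability at least $1-\epsilon$ Algorithm 1 (described in the context) consumes at most $c_i$ units of every resource $i$ and obtains total type-$i$ profit at least $W_{E}(1-2\epsilon)$ for every $i$ (i.e. achieves objective value $W_{E}(1-2\epsilon)$). The algorithm requires no knowledge of the distribution except the single parameter $W_{E}$.
   Context: Online resource allocation problem: $n$ resources indexed by $i$, resource $i$ having capacity $c_i>0$. Each request $j$ can be served by one option $k$ from a finite set $\mathcal{K}$ or dropped (null option $\bot$ with zero consumption and profit); option $k$ for request $j$ consumes $a_{ijk}\geq0$ of resource $i$ and yields type-$i$ profit $w_{ijk}\geq 0$. $m$ requests arrive one by one, drawn i.i.d. from an unknown distribution over request types $j\in\mathcal{J}$ with probabilities $p_j$, and each is irrevocably served or dropped on arrival. The objective is $\min_i$(total type-$i$ profit) subject to consumption of resource $i$ being at most $c_i$. $W_{E}$ is the optimal value of the expected-instance LP: maximize $\lambda$ s.t. $\sum_{j,k}mp_jw_{ijk}x_{jk}\geq\lambda$ and $\sum_{j,k}mp_ja_{ijk}x_{jk}\leq c_i$ for all $i$, $\sum_k x_{jk}\leq 1$, $x\geq 0$. $\gamma=\max(\{a_{ijk}/c_i\}\cup\{w_{ijk}/W_{E}\})$. Algorithm 1 (inputs: $c_i$, $m$, $\gamma$, $W_{E}$, $\epsilon$): after $s$ requests have been processed, let $S^x_{i,s}$ and $S^y_{i,s}$ be the total consumption of resource $i$ and total type-$i$ profit so far,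 and define $\phi_{i,s}=\frac{1}{c_i}\cdot\frac{(1+\epsilon)^{S^x_{i,s}/(\gamma c_i)}\big(1+\frac{\epsilon}{(1+\epsilon)\gamma m}\big)^{m-s-1}}{(1+\epsilon)^{1/\gamma}}$ and $\psi_{i,s}=\frac{1}{W_{E}}\cdot\frac{(1-\epsilon)^{S^y_{i,s}/(\gamma W_{E})}\big(1-\frac{\epsilon}{(1+\epsilon)\gamma m}\big)^{m-s-1}}{(1-\epsilon)^{(1-\epsilon)/(\gamma(1+\epsilon))}}$. When the $s$-th request $j$ arrives ($s=1,\dots,m$), serve it with $k^*=\arg\min_{k\in\mathcal{K}\cup\{\bot\}}\{\sum_i a_{ijk}\phi_{i,s-1}-\sum_i w_{ijk}\psi_{i,s-1}\}$.
   Formalization: For a single resource (n = 1) the formal theorem assumes ε ≤ 1/2, because the statement fails for n = 1 and ε close to 1, where log(n/ε) tends to 0 and γ is unconstrained; for n ≥ 2 every ε > 0 is covered. *)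

theory Defs
  imports "HOL-Probability.Probability"
begin

(* Resources are the indices i < nres.  Options and request types are sets of natural numbers
   (rather than type variables), so that a constant can be quantified outside of all instances. *)
record rap =
  nres :: nat
  cap :: "nat \<Rightarrow> real"
  opts :: "nat set"
  reqs :: "nat set"
  consumption :: "nat \<Rightarrow> nat \<Rightarrow> nat \<Rightarrow> real"
  profit :: "nat \<Rightarrow> nat \<Rightarrow> nat \<Rightarrow> real"

(* The boundedness conditions make the parameter gamma finite; they hold automatically when
   the set of request types is finite. *)
definition valid_rap :: "rap \<Rightarrow> bool" where
  "valid_rap I \<longleftrightarrow>
     0 < nres I \<and>
     (\<forall>i<nres I. 0 < cap I i) \<and>
     finite (opts I) \<and>
     (\<forall>i<nres I. \<forall>j\<in>reqs I. \<forall>k\<in>opts I. 0 \<le> consumption I i j k \<and> 0 \<le> profit I i j k) \<and>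
     bdd_above {consumption I i j k | i j k. i < nres I \<and> j \<in> reqs I \<and> k \<in> opts I} \<and>
     bdd_above {profit I i j k | i j k. i < nres I \<and> j \<in> reqs I \<and> k \<in> opts I}"

definition lp_feasible :: "rap \<Rightarrow> nat \<Rightarrow> nat pmf \<Rightarrow> (nat \<Rightarrow> nat \<Rightarrow> real) \<Rightarrow> real \<Rightarrow> bool" where
  "lp_feasible I m p x lam \<longleftrightarrow>
     (\<forall>i<nres I. (\<Sum>\<^sub>\<infinity>j\<in>reqs I. \<Sum>k\<in>opts I. real m * pmf p j * profit I i j k * x j k) \<ge> lam) \<and>
     (\<forall>i<nres I. (\<Sum>\<^sub>\<infinity>j\<in>reqs I. \<Sum>k\<in>opts I. real m * pmf p j * consumption I i j k * x j k) \<le> cap I i) \<and>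
     (\<forall>j\<in>reqs I. (\<Sum>k\<in>opts I. x j k) \<le> 1) \<and>
     (\<forall>j\<in>reqs I. \<forall>k\<in>opts I. 0 \<le> x j k)"

definition W_E :: "rap \<Rightarrow> nat \<Rightarrow> nat pmf \<Rightarrow> real" where
  "W_E I m p = Sup {lam. \<exists>x. lp_feasible I m p x lam}"

definition gamma_of :: "rap \<Rightarrow> real \<Rightarrow> real" where
  "gamma_of I W = Sup
     ({consumption I i j k / cap I i | i j k. i < nres I \<and> j \<in> reqs I \<and> k \<in> opts I} \<union>
      {profit I i j k / W | i j k. i < nres I \<and> j \<in> reqs I \<and> k \<in> opts I})"

(* None is the null option. *)
definition with_null :: "(nat \<Rightarrow> nat \<Rightarrow> nat \<Rightarrow> real) \<Rightarrow> nat \<Rightarrow> nat \<Rightarrow> nat option \<Rightarrow> real" where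
  "with_null f i j k = (case k of None \<Rightarrow> 0 | Some k' \<Rightarrow> f i j k')"

(* The requests processed so far, in order of arrival, each with the option it was given. *)
type_synonym history = "(nat \<times> nat option) list"

definition total_amount :: "(nat \<Rightarrow> nat \<Rightarrow> nat \<Rightarrow> real) \<Rightarrow> nat \<Rightarrow> history \<Rightarrow> real" where
  "total_amount f i h = (\<Sum>(j, k)\<leftarrow>h. with_null f i j k)"

(* The number s of processed requests is the length of the history. *)
definition phi :: "rap \<Rightarrow> nat \<Rightarrow> real \<Rightarrow> real \<Rightarrow> history \<Rightarrow> nat \<Rightarrow> real" where
  "phi I m \<gamma> \<epsilon> h i =
     1 / cap I i *
     ((1 + \<epsilon>) powr (total_amount (consumption I) i h / (\<gamma> * cap I i)) *
        (1 + \<epsilon> / ((1 + \<epsilon>) * \<gamma> * real m)) ^ (m - length h - 1)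
      / (1 + \<epsilon>) powr (1 / \<gamma>))"

definition psi :: "rap \<Rightarrow> nat \<Rightarrow> real \<Rightarrow> real \<Rightarrow> real \<Rightarrow> history \<Rightarrow> nat \<Rightarrow> real" where
  "psi I m \<gamma> W \<epsilon> h i =
     1 / W *
     ((1 - \<epsilon>) powr (total_amount (profit I) i h / (\<gamma> * W)) *
        (1 - \<epsilon> / ((1 + \<epsilon>) * \<gamma> * real m)) ^ (m - length h - 1)
      / (1 - \<epsilon>) powr ((1 - \<epsilon>) / (\<gamma> * (1 + \<epsilon>))))"

definition score :: "rap \<Rightarrow> nat \<Rightarrow> real \<Rightarrow> real \<Rightarrow> real \<Rightarrow> history \<Rightarrow> nat \<Rightarrow> nat option \<Rightarrow> real" where
  "score I m \<gamma> W \<epsilon> h j k =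
     (\<Sum>i<nres I. with_null (consumption I) i j k * phi I m \<gamma> \<epsilon> h i) -
     (\<Sum>i<nres I. with_null (profit I) i j k * psi I m \<gamma> W \<epsilon> h i)"

(* A policy maps the history and the arriving request to an option.  The policies below are the
   versions of the algorithm with every possible (history-dependent) way of breaking ties in the
   arg min.  The request distribution is not an argument. *)
definition is_algorithm1 ::
    "rap \<Rightarrow> nat \<Rightarrow> real \<Rightarrow> real \<Rightarrow> real \<Rightarrow> (history \<Rightarrow> nat \<Rightarrow> nat option) \<Rightarrow> bool" where
  "is_algorithm1 I m \<gamma> W \<epsilon> alg \<longleftrightarrow>
     (\<forall>h. \<forall>j\<in>reqs I. length h < m \<longrightarrow>
        is_arg_min (score I m \<gamma> W \<epsilon> h j) (\<lambda>k. k \<in> insert None (Some ` opts I)) (alg h j))"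

definition run :: "(history \<Rightarrow> nat \<Rightarrow> nat option) \<Rightarrow> nat list \<Rightarrow> history" where
  "run alg js = foldl (\<lambda>h j. h @ [(j, alg h j)]) [] js"

lemma ex_is_algorithm1:
  assumes "valid_rap I"
  shows "\<exists>alg. is_algorithm1 I m \<gamma> W \<epsilon> alg"
proof -
  have "finite (insert None (Some ` opts I))"
    using assms by (simp add: valid_rap_def)
  then have "\<forall>h j. \<exists>k. is_arg_min (score I m \<gamma> W \<epsilon> h j) (\<lambda>k. k \<in> insert None (Some ` opts I)) k"
    by (intro allI ex_is_arg_min_if_finite) auto
  then show ?thesis
    unfolding is_algorithm1_def by metis
qed

end

theory Submission
  imports Defs
begin

text \<open>
  Call the run bad if some consumption exceeds its capacity or some profit misses its target. The
  potential of a history is a pessimistic estimator for the probability of ending badly: it is the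
  sum, over all \<open>2 n\<close> constraints, of an exponential moment that charges the remaining requests
  the factors \<open>1 + rate\<close> and \<open>1 - rate\<close>, and it is at least 1 after a bad run. By
  \<open>x powr t \<le> 1 + t (x - 1)\<close>, serving a request changes the potential by at most an affine function of
  the score that the algorithm minimises. Scaling a near-optimal solution of the linear program by
  \<open>1 / (1 + \<epsilon>)\<close> shows that the expected minimal score is small enough for the potential not to
  increase on average. Hence the probability of a bad run is at most the initial potential, which is
  at most \<open>2 n exp (- \<epsilon>\<^sup>2 / (8 \<gamma>)) \<le> 2 \<epsilon>\<^sup>2 / n \<le> \<epsilon>\<close> for \<open>c = 1 / 16\<close>.
\<close>

section \<open>Elementary inequalities for exponentials and logarithms\<close>

text \<open>Convexity of exp on the segment from 0 to \<open>ln x\<close>. It linearises the effect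
  of one request on an exponential moment; \<open>t\<close> will be a consumption or profit divided
  by the bound that \<open>\<gamma>\<close> gives for it, hence the range [0, 1].\<close>

lemma powr_le_linear:
  fixes x t :: real
  assumes "0 < x" "0 \<le> t" "t \<le> 1"
  shows "x powr t \<le> 1 + t * (x - 1)"
proof -
  have "exp ((1 - t) *\<^sub>R 0 + t *\<^sub>R ln x) \<le> (1 - t) * exp 0 + t * exp (ln x)"
    using assms by (intro convex_onD[OF exp_convex]) auto
  then show ?thesis
    using assms by (simp add: powr_def algebra_simps)
qed

text \<open>Both sides vanish at 0, and their difference has derivative
  \<open>y * (1 / (1 + y)\<^sup>2 - 1 / 4)\<close>, nonnegative while \<open>1 + y \<le> 2\<close>;
  this is where 1/8 comes from. It controls the capacity terms of the initial potential.\<close>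

lemma ln_one_plus_minus_fraction_ge:
  fixes x :: real
  assumes "0 \<le> x" "x \<le> 1"
  shows "x\<^sup>2 / 8 \<le> ln (1 + x) - x / (1 + x)"
proof -
  let ?f = "\<lambda>x::real. ln (1 + x) - x / (1 + x) - x\<^sup>2 / 8"
  have "?f 0 \<le> ?f x"
  proof (rule DERIV_nonneg_imp_nondecreasing[OF assms(1)])
    fix y :: real
    assume y: "0 \<le> y" "y \<le> x"
    have "(?f has_real_derivative
        1 / (1 + y) - (1 * (1 + y) - y * 1) / ((1 + y) * (1 + y)) - 2 * y / 8) (at y)"
      using y by (auto intro!: derivative_eq_intros)
    moreover have "1 / (1 + y) - (1 * (1 + y) - y * 1) / ((1 + y) * (1 + y)) - 2 * y / 8 =
        y * (1 / (1 + y)\<^sup>2 - 1 / 4)"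
      using y by (simp add: divide_simps power2_eq_square) (simp add: algebra_simps)
    ultimately have "(?f has_real_derivative y * (1 / (1 + y)\<^sup>2 - 1 / 4)) (at y)"
      by simp
    moreover have "(1 + y)\<^sup>2 \<le> 2\<^sup>2"
      using y assms by (intro power_mono) auto
    then have "1 / 4 \<le> 1 / (1 + y)\<^sup>2"
      using y by (intro divide_left_mono) auto
    ultimately show "\<exists>d. (?f has_real_derivative d) (at y) \<and> 0 \<le> d"
      using y by (intro exI[of _ "y * (1 / (1 + y)\<^sup>2 - 1 / 4)"]) auto
  qed
  then show ?thesis by simp
qed

text \<open>Monotonicity again, with derivative \<open>- ln (1 - y) - y\<close> of the difference.
  It controls the profit terms of the initial potential.\<close>

lemma one_minus_mult_ln_ge:
  fixes x :: real
  assumes "0 \<le> x" "x < 1"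
  shows "x\<^sup>2 / 2 \<le> x + (1 - x) * ln (1 - x)"
proof -
  let ?f = "\<lambda>x::real. x + (1 - x) * ln (1 - x) - x\<^sup>2 / 2"
  have "?f 0 \<le> ?f x"
  proof (rule DERIV_nonneg_imp_nondecreasing[OF assms(1)])
    fix y :: real
    assume y: "0 \<le> y" "y \<le> x"
    have "(?f has_real_derivative - ln (1 - y) - y) (at y)"
      using y assms by (auto intro!: derivative_eq_intros)
    moreover have "ln (1 + - y) \<le> - y"
      using y assms by (intro ln_add_one_self_le_self2) auto
    ultimately show "\<exists>d. (?f has_real_derivative d) (at y) \<and> 0 \<le> d"
      by (intro exI[of _ "- ln (1 - y) - y"]) auto
  qed
  then show ?thesis by simp
qed

section \<open>Expectations and probabilities under discrete distributions\<close>

text \<open>Links the infinite sums of the linear program to expectations. Integrability supplies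
  absolute summability, and terms outside the support are 0.\<close>

lemma infsum_pmf_mult_eq_expectation:
  fixes f :: "'a \<Rightarrow> real"
  assumes "integrable (measure_pmf p) f" "set_pmf p \<subseteq> A"
  shows "(\<Sum>\<^sub>\<infinity>j\<in>A. pmf p j * f j) = measure_pmf.expectation p f"
proof -
  have "integrable (count_space UNIV) (\<lambda>j. pmf p j * f j)"
    using assms(1) by (simp add: measure_pmf_eq_density integrable_density)
  then have "Infinite_Set_Sum.abs_summable_on (\<lambda>j. pmf p j * f j) UNIV"
    by (simp add: abs_summable_on_def)
  then have "measure_pmf.expectation p f = (\<Sum>\<^sub>\<infinity>j. pmf p j * f j)"
    by (simp add: pmf_expectation_eq_infsetsum infsetsum_infsum)
  also have "\<dots> = (\<Sum>\<^sub>\<infinity>j\<in>A. pmf p j * f j)"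
    using assms(2) by (intro infsum_cong_neutral) (auto simp: set_pmf_iff)
  finally show ?thesis by simp
qed

text \<open>Total probability, for conditioning on the next request.\<close>

lemma measure_bind_pmf:
  "measure_pmf.prob (bind_pmf p f) A = measure_pmf.expectation p (\<lambda>x. measure_pmf.prob (f x) A)"
proof -
  have "ennreal (measure_pmf.prob (bind_pmf p f) A) =
      (\<integral>\<^sup>+x. ennreal (measure_pmf.prob (f x) A) \<partial>measure_pmf p)"
    by (simp add: measure_pmf.emeasure_eq_measure[symmetric])
  also have "\<dots> = ennreal (measure_pmf.expectation p (\<lambda>x. measure_pmf.prob (f x) A))"
    by (intro nn_integral_eq_integral measure_pmf.integrable_const_bound[where B = 1]) auto
  finally show ?thesis
    by (simp add: integral_nonneg)
qed

lemma total_amount_Nil [simp]: "total_amount f i [] = 0"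
  by (simp add: total_amount_def)

lemma total_amount_snoc [simp]:
  "total_amount f i (h @ [(j, k)]) = total_amount f i h + with_null f i j k"
  by (simp add: total_amount_def)

section \<open>The expected-instance linear program and its parameters\<close>

locale random_instance =
  fixes I :: rap and m :: nat and p :: "nat pmf"
  assumes valid: "valid_rap I"
    and support: "set_pmf p \<subseteq> reqs I"
begin

abbreviation "W \<equiv> W_E I m p"
abbreviation "\<gamma> \<equiv> gamma_of I W"

lemma nres_pos: "0 < nres I"
  and cap_pos: "i < nres I \<Longrightarrow> 0 < cap I i"
  and consumption_nonneg:
    "i < nres I \<Longrightarrow> j \<in> reqs I \<Longrightarrow> k \<in> opts I \<Longrightarrow> 0 \<le> consumption I i j k"
  and profit_nonneg:
    "i < nres I \<Longrightarrow> j \<in> reqs I \<Longrightarrow> k \<in> opts I \<Longrightarrow> 0 \<le> profit I i j k"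
  using valid by (auto simp: valid_rap_def)

lemma consumption_bounded:
  obtains M where "0 \<le> M"
    "\<And>i j k. i < nres I \<Longrightarrow> j \<in> reqs I \<Longrightarrow> k \<in> opts I \<Longrightarrow> consumption I i j k \<le> M"
proof -
  have "bdd_above {consumption I i j k | i j k. i < nres I \<and> j \<in> reqs I \<and> k \<in> opts I}"
    using valid by (simp add: valid_rap_def)
  then obtain M where
    M: "\<And>y. y \<in> {consumption I i j k | i j k. i < nres I \<and> j \<in> reqs I \<and> k \<in> opts I} \<Longrightarrow> y \<le> M"
    by (rule bdd_above.E) (rule that)
  have "consumption I i j k \<le> max 0 M" if "i < nres I" "j \<in> reqs I" "k \<in> opts I" for i j k
    using that by (intro max.coboundedI2 M) blast
  then show ?thesis
    by (rule that[OF max.cobounded1])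
qed

lemma profit_bounded:
  obtains M where "0 \<le> M"
    "\<And>i j k. i < nres I \<Longrightarrow> j \<in> reqs I \<Longrightarrow> k \<in> opts I \<Longrightarrow> profit I i j k \<le> M"
proof -
  have "bdd_above {profit I i j k | i j k. i < nres I \<and> j \<in> reqs I \<and> k \<in> opts I}"
    using valid by (simp add: valid_rap_def)
  then obtain M where
    M: "\<And>y. y \<in> {profit I i j k | i j k. i < nres I \<and> j \<in> reqs I \<and> k \<in> opts I} \<Longrightarrow> y \<le> M"
    by (rule bdd_above.E) (rule that)
  have "profit I i j k \<le> max 0 M" if "i < nres I" "j \<in> reqs I" "k \<in> opts I" for i j k
    using that by (intro max.coboundedI2 M) blast
  then show ?thesis
    by (rule that[OF max.cobounded1])
qed

text \<open>The weights \<open>x j k\<close> sum to at most 1, so the inner sum lies in [0, M] on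
  the support and is integrable. The third claim turns the rows of the linear program into
  \<open>m\<close> times expectations.\<close>

lemma fractional_expectation:
  fixes x f :: "nat \<Rightarrow> nat \<Rightarrow> real"
  assumes x: "\<forall>j\<in>reqs I. (\<Sum>k\<in>opts I. x j k) \<le> 1" "\<forall>j\<in>reqs I. \<forall>k\<in>opts I. 0 \<le> x j k"
    and f: "\<And>j k. j \<in> reqs I \<Longrightarrow> k \<in> opts I \<Longrightarrow> 0 \<le> f j k"
      "\<And>j k. j \<in> reqs I \<Longrightarrow> k \<in> opts I \<Longrightarrow> f j k \<le> M"
    and M: "0 \<le> M"
  shows "integrable (measure_pmf p) (\<lambda>j. \<Sum>k\<in>opts I. f j k * x j k)" (is ?int)
    and "measure_pmf.expectation p (\<lambda>j. \<Sum>k\<in>opts I. f j k * x j k) \<le> M" (is ?le)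
    and "(\<Sum>\<^sub>\<infinity>j\<in>reqs I. \<Sum>k\<in>opts I. real m * pmf p j * f j k * x j k) =
      real m * measure_pmf.expectation p (\<lambda>j. \<Sum>k\<in>opts I. f j k * x j k)" (is ?eq)
proof -
  let ?g = "\<lambda>j. \<Sum>k\<in>opts I. f j k * x j k"
  have nonneg: "0 \<le> ?g j" if "j \<in> reqs I" for j
    using that x f by (intro sum_nonneg) auto
  have le: "?g j \<le> M" if "j \<in> reqs I" for j
  proof -
    have "?g j \<le> (\<Sum>k\<in>opts I. M * x j k)"
      using that x f by (intro sum_mono mult_right_mono) auto
    also have "\<dots> = M * (\<Sum>k\<in>opts I. x j k)"
      by (simp add: sum_distrib_left)
    also have "\<dots> \<le> M * 1"
      using that x M by (intro mult_left_mono) auto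
    finally show ?thesis by simp
  qed
  show int: ?int
    using nonneg le support
    by (intro measure_pmf.integrable_const_bound[where B = M]) (auto simp: AE_measure_pmf_iff)
  have "measure_pmf.expectation p ?g \<le> measure_pmf.expectation p (\<lambda>_. M)"
    using int le support by (intro integral_mono_AE) (auto simp: AE_measure_pmf_iff)
  then show ?le by simp
  have "(\<Sum>\<^sub>\<infinity>j\<in>reqs I. \<Sum>k\<in>opts I. real m * pmf p j * f j k * x j k) =
      (\<Sum>\<^sub>\<infinity>j\<in>reqs I. real m * (pmf p j * ?g j))"
    by (simp add: sum_distrib_left mult.assoc)
  also have "\<dots> = real m * (\<Sum>\<^sub>\<infinity>j\<in>reqs I. pmf p j * ?g j)"
    by (rule infsum_cmult_right')
  finally show ?eq
    by (simp add: infsum_pmf_mult_eq_expectation[OF int support])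
qed

lemma lp_feasible_zero: "lp_feasible I m p (\<lambda>_ _. 0) 0"
  using cap_pos by (auto simp: lp_feasible_def less_imp_le)

text \<open>The profit row of resource 0 already gives the bound. It serves twice: the supremum
  \<open>W\<close> is over a bounded set, and \<open>m * \<gamma>\<close> is bounded from
  below.\<close>

lemma lp_feasible_value_le:
  assumes "lp_feasible I m p x lam"
    and "\<And>i j k. i < nres I \<Longrightarrow> j \<in> reqs I \<Longrightarrow> k \<in> opts I \<Longrightarrow> profit I i j k \<le> B" "0 \<le> B"
  shows "lam \<le> real m * B"
proof -
  have x: "\<forall>j\<in>reqs I. (\<Sum>k\<in>opts I. x j k) \<le> 1" "\<forall>j\<in>reqs I. \<forall>k\<in>opts I. 0 \<le> x j k"
    using assms(1) by (auto simp: lp_feasible_def)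
  note exp = fractional_expectation[OF x, of "profit I 0" B,
      OF profit_nonneg[OF nres_pos] assms(2)[OF nres_pos] assms(3)]
  have "lam \<le> (\<Sum>\<^sub>\<infinity>j\<in>reqs I. \<Sum>k\<in>opts I. real m * pmf p j * profit I 0 j k * x j k)"
    using assms(1) nres_pos unfolding lp_feasible_def by blast
  also have "\<dots> = real m * measure_pmf.expectation p (\<lambda>j. \<Sum>k\<in>opts I. profit I 0 j k * x j k)"
    by (rule exp(3))
  also have "\<dots> \<le> real m * B"
    using exp(2) by (intro mult_left_mono) auto
  finally show ?thesis .
qed

lemma W_E_nonneg: "0 \<le> W"
proof -
  obtain M where M: "0 \<le> M"
    "\<And>i j k. i < nres I \<Longrightarrow> j \<in> reqs I \<Longrightarrow> k \<in> opts I \<Longrightarrow> profit I i j k \<le> M"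
    using profit_bounded by blast
  have "bdd_above {lam. \<exists>x. lp_feasible I m p x lam}"
    using lp_feasible_value_le[OF _ M(2,1)] by (intro bdd_aboveI[of _ "real m * M"]) auto
  then show ?thesis
    unfolding W_E_def using lp_feasible_zero by (intro cSup_upper) auto
qed

text \<open>The supremum need not be attained, so facts about \<open>W\<close> are derived from
  bounds valid for every feasible value.\<close>

lemma W_E_le:
  assumes "\<And>x lam. lp_feasible I m p x lam \<Longrightarrow> lam \<le> B"
  shows "W \<le> B"
  unfolding W_E_def using assms lp_feasible_zero by (intro cSup_least) auto

lemma gamma_of_bounds:
  assumes "i < nres I" "j \<in> reqs I" "k \<in> opts I"
  shows "consumption I i j k / cap I i \<le> \<gamma>" "profit I i j k / W \<le> \<gamma>"
proof -
  obtain M where M: "0 \<le> M"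
    "\<And>i j k. i < nres I \<Longrightarrow> j \<in> reqs I \<Longrightarrow> k \<in> opts I \<Longrightarrow> consumption I i j k \<le> M"
    using consumption_bounded by blast
  \<comment> \<open>Capacities differ between resources; summing over all of them gives a bound
    uniform in \<open>i\<close>.\<close>
  have "consumption I i j k / cap I i \<le> (\<Sum>i<nres I. M / cap I i)"
    if "i < nres I" "j \<in> reqs I" "k \<in> opts I" for i j k
  proof -
    have "consumption I i j k / cap I i \<le> M / cap I i"
      using that M(2) cap_pos by (intro divide_right_mono) (auto simp: less_imp_le)
    also have "\<dots> \<le> (\<Sum>i<nres I. M / cap I i)"
      using that M(1) cap_pos
      by (intro member_le_sum) (auto intro!: divide_nonneg_pos)
    finally show ?thesis .
  qed
  then have "bdd_above {consumption I i j k / cap I i | i j k. i < nres I \<and> j \<in> reqs I \<and> k \<in> opts I}"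
    by (intro bdd_aboveI) auto
  moreover
  obtain M' where M': "0 \<le> M'"
    "\<And>i j k. i < nres I \<Longrightarrow> j \<in> reqs I \<Longrightarrow> k \<in> opts I \<Longrightarrow> profit I i j k \<le> M'"
    using profit_bounded by blast
  \<comment> \<open>This includes \<open>W = 0\<close>, where all quotients are 0.\<close>
  have "bdd_above {profit I i j k / W | i j k. i < nres I \<and> j \<in> reqs I \<and> k \<in> opts I}"
    using M'(2) W_E_nonneg by (intro bdd_aboveI[of _ "M' / W"]) (auto intro!: divide_right_mono)
  ultimately have bdd: "bdd_above
     ({consumption I i j k / cap I i | i j k. i < nres I \<and> j \<in> reqs I \<and> k \<in> opts I} \<union>
      {profit I i j k / W | i j k. i < nres I \<and> j \<in> reqs I \<and> k \<in> opts I})"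
    by simp
  show "consumption I i j k / cap I i \<le> \<gamma>" "profit I i j k / W \<le> \<gamma>"
    unfolding gamma_of_def using assms by (intro cSup_upper[OF _ bdd]; blast)+
qed

lemma gamma_of_nonneg:
  assumes "opts I \<noteq> {}"
  shows "0 \<le> \<gamma>"
proof -
  obtain j k where jk: "j \<in> reqs I" "k \<in> opts I"
    using support set_pmf_not_empty[of p] assms by blast
  have "0 \<le> consumption I 0 j k / cap I 0"
    using jk nres_pos by (auto intro!: divide_nonneg_pos consumption_nonneg cap_pos)
  then show ?thesis
    using gamma_of_bounds(1)[OF nres_pos jk] by linarith
qed

text \<open>Requests yield at most \<open>\<gamma> * W\<close> each, and \<open>m\<close> of them
  must suffice for \<open>W\<close>. This later gives \<open>\<gamma> > 0\<close> and keeps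
  \<open>1 - rate\<close> positive.\<close>

lemma one_le_m_gamma:
  assumes "0 < W"
  shows "1 \<le> real m * \<gamma>"
proof (cases "opts I = {}")
  case True
  then have "W \<le> real m * 0"
    by (intro W_E_le lp_feasible_value_le) auto
  with assms show ?thesis by simp
next
  case False
  have "W \<le> real m * (\<gamma> * W)"
    using gamma_of_nonneg[OF False] gamma_of_bounds(2) assms
    by (intro W_E_le lp_feasible_value_le) (auto simp: pos_divide_le_eq)
  then have "1 * W \<le> (real m * \<gamma>) * W"
    by simp
  then show ?thesis
    using assms by (simp only: mult_le_cancel_right_pos)
qed

section \<open>Choices of the algorithm, and the case of optimum zero\<close>

lemma algorithm1_option:
  assumes "is_algorithm1 I m g V \<epsilon> alg" "length h < m" "j \<in> reqs I"
  shows "alg h j \<in> insert None (Some ` opts I)"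
    and "k \<in> insert None (Some ` opts I) \<Longrightarrow> score I m g V \<epsilon> h j (alg h j) \<le> score I m g V \<epsilon> h j k"
  using assms unfolding is_algorithm1_def is_arg_min_linorder by blast+

lemma with_null_nonneg:
  assumes "i < nres I" "j \<in> reqs I" "k \<in> insert None (Some ` opts I)"
  shows "0 \<le> with_null (consumption I) i j k" "0 \<le> with_null (profit I) i j k"
  using assms consumption_nonneg profit_nonneg by (auto simp: with_null_def)

text \<open>With \<open>W = 0\<close> the weights \<^term>\<open>psi\<close> vanish because \<open>1 / 0 = 0\<close>, and the algorithm never pays for
  an option.\<close>

lemma no_consumption_if_W_E_zero:
  assumes "W = 0" and eps: "0 < \<epsilon>" and alg: "is_algorithm1 I m \<gamma> W \<epsilon> alg"
    and h: "length h < m" and j: "j \<in> reqs I" and i: "i < nres I"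
  shows "with_null (consumption I) i j (alg h j) = 0"
proof (cases "alg h j")
  case None
  then show ?thesis by (simp add: with_null_def)
next
  case (Some k)
  note opt = algorithm1_option[OF alg h j]
  have "0 \<le> \<gamma>"
    using Some opt(1) by (intro gamma_of_nonneg) auto
  then have base: "1 \<le> 1 + \<epsilon> / ((1 + \<epsilon>) * \<gamma> * real m)"
    using eps by simp
  have phi_pos: "0 < phi I m \<gamma> \<epsilon> h i" if "i < nres I" for i
    unfolding phi_def using that cap_pos[OF that] eps base
    by (intro mult_pos_pos divide_pos_pos zero_less_power) auto
  have nonneg: "0 \<le> with_null (consumption I) i j (alg h j) * phi I m \<gamma> \<epsilon> h i" if "i < nres I" for i
    using that with_null_nonneg(1)[OF that j opt(1)] phi_pos[OF that] by simp
  \<comment> \<open>Compared with dropping the request, whose score is 0.\<close>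
  have "(\<Sum>i<nres I. with_null (consumption I) i j (alg h j) * phi I m \<gamma> \<epsilon> h i) \<le> 0"
    using opt(2)[of None] \<open>W = 0\<close> by (simp add: score_def psi_def with_null_def)
  then have "(\<Sum>i<nres I. with_null (consumption I) i j (alg h j) * phi I m \<gamma> \<epsilon> h i) = 0"
    using nonneg by (intro antisym sum_nonneg) auto
  then have "with_null (consumption I) i j (alg h j) * phi I m \<gamma> \<epsilon> h i = 0"
    using nonneg i by (subst (asm) sum_nonneg_eq_0_iff) auto
  then show ?thesis
    using phi_pos[OF i] by simp
qed

end

lemma length_run [simp]: "length (run alg js) = length js"
  by (induction js rule: rev_induct) (simp_all add: run_def)

lemma run_snoc: "run alg (js @ [j]) = run alg js @ [(j, alg (run alg js) j)]"
  by (simp add: run_def)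

text \<open>For \<open>W = 0\<close> the profit target is 0, so this makes every run in the support
  good.\<close>

lemma (in random_instance) run_if_W_E_zero:
  assumes "W = 0" "0 < \<epsilon>" "is_algorithm1 I m \<gamma> W \<epsilon> alg" "i < nres I"
    and "length js \<le> m" "set js \<subseteq> reqs I"
  shows "total_amount (consumption I) i (run alg js) = 0 \<and>
    0 \<le> total_amount (profit I) i (run alg js)"
  using assms(5,6)
proof (induction js rule: rev_induct)
  case Nil
  then show ?case by (simp add: run_def)
next
  case (snoc j js)
  then have len: "length (run alg js) < m" and j: "j \<in> reqs I"
    by auto
  show ?case
    using snoc no_consumption_if_W_E_zero[OF assms(1-3) len j assms(4)]
      with_null_nonneg(2)[OF assms(4) j algorithm1_option(1)[OF assms(3) len j]]
    by (simp add: run_snoc)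
qed

section \<open>The main case: weights and expected score\<close>

locale algorithm1_run = random_instance +
  fixes \<epsilon> :: real and alg :: "history \<Rightarrow> nat \<Rightarrow> nat option"
  assumes eps_pos: "0 < \<epsilon>" and eps_less_1: "\<epsilon> < 1"
    and alg: "is_algorithm1 I m \<gamma> W \<epsilon> alg"
    and W_pos: "0 < W"
begin

lemma m_pos: "0 < m"
  using one_le_m_gamma[OF W_pos] by (cases m) auto

lemma gamma_pos: "0 < \<gamma>"
proof -
  have "0 < real m * \<gamma>"
    using one_le_m_gamma[OF W_pos] by linarith
  then show ?thesis
    using m_pos by (simp add: zero_less_mult_iff)
qed

text \<open>The slope \<open>\<epsilon> / \<gamma>\<close> of a linearised moment times
  \<open>1 / ((1 + \<epsilon>) * m)\<close>, the fraction of a capacity that the scaled solution of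
  the linear program may use per request on average.\<close>

definition rate :: real where "rate = \<epsilon> / ((1 + \<epsilon>) * \<gamma> * real m)"

lemma rate_pos: "0 < rate"
  using eps_pos gamma_pos m_pos by (simp add: rate_def)

lemma rate_less_1: "rate < 1"
proof -
  have "(1 + \<epsilon>) * 1 \<le> (1 + \<epsilon>) * (real m * \<gamma>)"
    using one_le_m_gamma[OF W_pos] eps_pos by (intro mult_left_mono) auto
  then have "\<epsilon> < (1 + \<epsilon>) * \<gamma> * real m"
    by (simp add: algebra_simps)
  then show ?thesis
    using eps_pos gamma_pos m_pos by (simp add: rate_def)
qed

abbreviation "\<phi> \<equiv> phi I m \<gamma> \<epsilon>"
abbreviation "\<psi> \<equiv> psi I m \<gamma> W \<epsilon>"

lemma phi_nonneg: "i < nres I \<Longrightarrow> 0 \<le> \<phi> h i"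
  using cap_pos[of i] rate_pos eps_pos unfolding phi_def rate_def[symmetric]
  by (intro mult_nonneg_nonneg divide_nonneg_nonneg zero_le_power) auto

lemma psi_nonneg: "0 \<le> \<psi> h i"
  using W_pos rate_less_1 unfolding psi_def rate_def[symmetric]
  by (intro mult_nonneg_nonneg divide_nonneg_nonneg zero_le_power) auto

lemma with_null_le:
  assumes "i < nres I" "j \<in> reqs I" "k \<in> insert None (Some ` opts I)"
  shows "with_null (consumption I) i j k \<le> \<gamma> * cap I i" "with_null (profit I) i j k \<le> \<gamma> * W"
  using assms gamma_of_bounds[of i j] gamma_pos cap_pos[of i] W_pos
  by (auto simp: with_null_def pos_divide_le_eq)

abbreviation "\<sigma> \<equiv> score I m \<gamma> W \<epsilon>"

text \<open>For a fixed history the weights are constants, and \<open>\<gamma>\<close> bounds every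
  consumption and profit, so the score is bounded.\<close>

lemma integrable_score:
  assumes "length h < m"
  shows "integrable (measure_pmf p) (\<lambda>j. \<sigma> h j (alg h j))"
proof (rule measure_pmf.integrable_const_bound)
  let ?B = "(\<Sum>i<nres I. \<gamma> * cap I i * \<phi> h i) + (\<Sum>i<nres I. \<gamma> * W * \<psi> h i)"
  have "\<bar>\<sigma> h j (alg h j)\<bar> \<le> ?B" if "j \<in> reqs I" for j
  proof -
    note opt = algorithm1_option(1)[OF alg assms that]
    let ?a = "\<Sum>i<nres I. with_null (consumption I) i j (alg h j) * \<phi> h i"
    let ?w = "\<Sum>i<nres I. with_null (profit I) i j (alg h j) * \<psi> h i"
    have "0 \<le> ?a" "0 \<le> ?w"
      using with_null_nonneg[OF _ that opt] phi_nonneg psi_nonneg by (auto intro!: sum_nonneg)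
    moreover have "?a \<le> (\<Sum>i<nres I. \<gamma> * cap I i * \<phi> h i)" "?w \<le> (\<Sum>i<nres I. \<gamma> * W * \<psi> h i)"
      using with_null_le[OF _ that opt] phi_nonneg psi_nonneg
      by (auto intro!: sum_mono mult_right_mono)
    ultimately show ?thesis
      unfolding score_def by linarith
  qed
  then show "AE j in measure_pmf p. norm (\<sigma> h j (alg h j)) \<le> ?B"
    using support by (auto simp: AE_measure_pmf_iff)
qed simp

text \<open>The arg min beats serving request \<open>j\<close> with option \<open>k\<close> with probability \<open>x j k / (1 + \<epsilon>)\<close>, for any
  feasible solution \<open>x\<close> of the expected-instance linear program.\<close>

lemma expected_score_le:
  assumes "length h < m"
  shows "measure_pmf.expectation p (\<lambda>j. \<sigma> h j (alg h j)) \<le>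
    ((\<Sum>i<nres I. cap I i * \<phi> h i) - (\<Sum>i<nres I. W * \<psi> h i)) / ((1 + \<epsilon>) * real m)"
    (is "?E \<le> (?C - _) / _")
proof -
  define d where "d = (1 + \<epsilon>) * real m"
  have d: "0 < d"
    using eps_pos m_pos by (simp add: d_def)
  let ?P = "\<Sum>i<nres I. \<psi> h i"
  have bound: "?E * d \<le> ?C - lam * ?P" if feas: "lp_feasible I m p x lam" for x lam
  proof -
    have x: "\<forall>j\<in>reqs I. (\<Sum>k\<in>opts I. x j k) \<le> 1" "\<forall>j\<in>reqs I. \<forall>k\<in>opts I. 0 \<le> x j k"
      using feas by (auto simp: lp_feasible_def)
    define A where "A i j = (\<Sum>k\<in>opts I. consumption I i j k * x j k)" for i j
    define V where "V i j = (\<Sum>k\<in>opts I. profit I i j k * x j k)" for i j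
    have A: "integrable (measure_pmf p) (A i)"
      "real m * measure_pmf.expectation p (A i) \<le> cap I i" if i: "i < nres I" for i
    proof -
      have le: "consumption I i j k \<le> \<gamma> * cap I i" if "j \<in> reqs I" "k \<in> opts I" for j k
        using gamma_of_bounds(1)[OF i that] cap_pos[OF i] by (simp add: pos_divide_le_eq)
      have "0 \<le> \<gamma> * cap I i"
        using gamma_pos cap_pos[OF i] by simp
      note exp = fractional_expectation[OF x consumption_nonneg[OF i] le this]
      show "integrable (measure_pmf p) (A i)"
        unfolding A_def by (rule exp(1))
      show "real m * measure_pmf.expectation p (A i) \<le> cap I i"
        unfolding A_def using feas i by (subst exp(3)[symmetric]) (auto simp: lp_feasible_def)
    qed
    have V: "integrable (measure_pmf p) (V i)"
      "lam \<le> real m * measure_pmf.expectation p (V i)" if i: "i < nres I" for i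
    proof -
      have le: "profit I i j k \<le> \<gamma> * W" if "j \<in> reqs I" "k \<in> opts I" for j k
        using gamma_of_bounds(2)[OF i that] W_pos by (simp add: pos_divide_le_eq)
      have "0 \<le> \<gamma> * W"
        using gamma_pos W_pos by simp
      note exp = fractional_expectation[OF x profit_nonneg[OF i] le this]
      show "integrable (measure_pmf p) (V i)"
        unfolding V_def by (rule exp(1))
      show "lam \<le> real m * measure_pmf.expectation p (V i)"
        unfolding V_def using feas i by (subst exp(3)[symmetric]) (auto simp: lp_feasible_def)
    qed
    \<comment> \<open>The null option makes the minimal score nonpositive, so replacing the factor
      \<open>1 + \<epsilon>\<close> by the smaller sum of the \<open>x j k\<close> can only raise
      the product; then the minimum is compared with each option.\<close>
    have pointwise: "(1 + \<epsilon>) * \<sigma> h j (alg h j) \<le> (\<Sum>i<nres I. \<phi> h i * A i j) - (\<Sum>i<nres I. \<psi> h i * V i j)"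
      if j: "j \<in> reqs I" for j
    proof -
      let ?s = "\<sigma> h j (alg h j)"
      have "?s \<le> 0"
        using algorithm1_option(2)[OF alg assms j, of None] by (simp add: score_def with_null_def)
      have "(\<Sum>k\<in>opts I. x j k) \<le> 1 + \<epsilon>"
        using x j eps_pos by force
      then have "(1 + \<epsilon>) * ?s \<le> (\<Sum>k\<in>opts I. x j k) * ?s"
        using \<open>?s \<le> 0\<close> by (rule mult_right_mono_neg)
      also have "\<dots> = (\<Sum>k\<in>opts I. x j k * ?s)"
        by (simp add: sum_distrib_right)
      also have "\<dots> \<le> (\<Sum>k\<in>opts I. x j k * \<sigma> h j (Some k))"
        using x j algorithm1_option(2)[OF alg assms j] by (intro sum_mono mult_left_mono) auto
      also have "\<dots> = (\<Sum>k\<in>opts I. (\<Sum>i<nres I. \<phi> h i * (consumption I i j k * x j k)) -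
          (\<Sum>i<nres I. \<psi> h i * (profit I i j k * x j k)))"
        by (simp add: score_def with_null_def right_diff_distrib sum_distrib_left mult_ac)
      also have "\<dots> = (\<Sum>i<nres I. \<phi> h i * A i j) - (\<Sum>i<nres I. \<psi> h i * V i j)"
        unfolding A_def V_def sum_subtractf sum_distrib_left
        by (intro arg_cong2[where f = minus] sum.swap)
      finally show ?thesis .
    qed
    have "(1 + \<epsilon>) * ?E = measure_pmf.expectation p (\<lambda>j. (1 + \<epsilon>) * \<sigma> h j (alg h j))"
      by simp
    also have "\<dots> \<le> measure_pmf.expectation p
        (\<lambda>j. (\<Sum>i<nres I. \<phi> h i * A i j) - (\<Sum>i<nres I. \<psi> h i * V i j))"
      using integrable_score[OF assms] A(1) V(1) pointwise support
      by (intro integral_mono_AE Bochner_Integration.integrable_diff Bochner_Integration.integrable_sum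
          integrable_mult_right) (auto simp: AE_measure_pmf_iff)
    also have "\<dots> = (\<Sum>i<nres I. \<phi> h i * measure_pmf.expectation p (A i)) -
        (\<Sum>i<nres I. \<psi> h i * measure_pmf.expectation p (V i))"
      using A(1) V(1) by (subst Bochner_Integration.integral_diff) (auto simp: Bochner_Integration.integral_sum)
    finally have "real m * ((1 + \<epsilon>) * ?E) \<le> real m * \<dots>"
      by (intro mult_left_mono) auto
    then have "?E * d \<le> (\<Sum>i<nres I. \<phi> h i * (real m * measure_pmf.expectation p (A i))) -
        (\<Sum>i<nres I. \<psi> h i * (real m * measure_pmf.expectation p (V i)))"
      by (simp add: d_def right_diff_distrib sum_distrib_left mult_ac)
    also have "\<dots> \<le> (\<Sum>i<nres I. \<phi> h i * cap I i) - (\<Sum>i<nres I. \<psi> h i * lam)"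
      using A(2) V(2) phi_nonneg psi_nonneg by (intro diff_mono sum_mono mult_left_mono) auto
    finally show ?thesis
      by (simp add: sum_distrib_left mult_ac)
  qed
  have "?E * d \<le> ?C - W * ?P"
  \<comment> \<open>If \<open>?P > 0\<close>, the bound is solved for \<open>lam\<close> and passes
    to the supremum. If \<open>?P = 0\<close>, \<open>lam\<close> drops out and the zero solution
    suffices.\<close>
  proof (cases "?P = 0")
    case True
    then show ?thesis
      using bound[OF lp_feasible_zero] by simp
  next
    case False
    then have "0 < ?P"
      using psi_nonneg by (simp add: less_le sum_nonneg)
    moreover have "W \<le> (?C - ?E * d) / ?P"
      using bound \<open>0 < ?P\<close> by (intro W_E_le) (simp add: pos_le_divide_eq algebra_simps)
    ultimately show ?thesis
      by (simp add: pos_le_divide_eq)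
  qed
  then show ?thesis
    using d by (simp add: d_def pos_le_divide_eq sum_distrib_left)
qed

section \<open>The potential along a run\<close>

text \<open>The exponent \<open>m - length h\<close> exceeds the one in \<open>\<phi>\<close> and
  \<open>\<psi>\<close> by 1 while requests remain: those weights leave out the factor for the
  request in hand.\<close>

definition potential :: "history \<Rightarrow> real" where
  "potential h =
     (\<Sum>i<nres I. (1 + \<epsilon>) powr (total_amount (consumption I) i h / (\<gamma> * cap I i)) *
        (1 + rate) ^ (m - length h) / (1 + \<epsilon>) powr (1 / \<gamma>)) +
     (\<Sum>i<nres I. (1 - \<epsilon>) powr (total_amount (profit I) i h / (\<gamma> * W)) *
        (1 - rate) ^ (m - length h) / (1 - \<epsilon>) powr ((1 - \<epsilon>) / (\<gamma> * (1 + \<epsilon>))))"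

lemma potential_summands_nonneg:
  "0 \<le> (1 + \<epsilon>) powr a * (1 + rate) ^ r / (1 + \<epsilon>) powr b"
  "0 \<le> (1 - \<epsilon>) powr a * (1 - rate) ^ r / (1 - \<epsilon>) powr b"
  using rate_pos rate_less_1 by simp_all

lemma potential_eq:
  assumes "length h < m"
  shows "potential h = (1 + rate) * (\<Sum>i<nres I. cap I i * \<phi> h i) + (1 - rate) * (\<Sum>i<nres I. W * \<psi> h i)"
proof -
  have "m - length h = Suc (m - length h - 1)"
    using assms by simp
  then show ?thesis
    unfolding potential_def phi_def psi_def rate_def[symmetric] sum_distrib_left
    using cap_pos W_pos by (intro arg_cong2[where f = plus] sum.cong) (simp_all add: less_imp_neq[symmetric])
qed

text \<open>After the new request the remaining exponent is that of \<open>\<phi>\<close> and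
  \<open>\<psi>\<close>, so each summand is \<open>cap I i * \<phi> h i\<close> or
  \<open>W * \<psi> h i\<close> times one new power. Linearising it by \<open>powr_le_linear\<close>
  gives slopes \<open>\<epsilon> / \<gamma>\<close> and \<open>- \<epsilon> / \<gamma>\<close>,
  which assemble into the score.\<close>

lemma potential_snoc_le:
  assumes "length h < m" "j \<in> reqs I" "k \<in> insert None (Some ` opts I)"
  shows "potential (h @ [(j, k)]) \<le>
    (\<Sum>i<nres I. cap I i * \<phi> h i) + (\<Sum>i<nres I. W * \<psi> h i) + \<epsilon> / \<gamma> * \<sigma> h j k"
proof -
  let ?a = "\<lambda>i. with_null (consumption I) i j k" and ?w = "\<lambda>i. with_null (profit I) i j k"
  have len: "m - length (h @ [(j, k)]) = m - length h - 1"
    by simp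
  have "(1 + \<epsilon>) powr (total_amount (consumption I) i (h @ [(j, k)]) / (\<gamma> * cap I i)) *
      (1 + rate) ^ (m - length h - 1) / (1 + \<epsilon>) powr (1 / \<gamma>) \<le>
      cap I i * \<phi> h i + \<epsilon> / \<gamma> * (?a i * \<phi> h i)" (is "?l \<le> ?r") if i: "i < nres I" for i
  proof -
    have "?l = cap I i * \<phi> h i * (1 + \<epsilon>) powr (?a i / (\<gamma> * cap I i))"
      using cap_pos[OF i] by (simp add: phi_def rate_def[symmetric] add_divide_distrib powr_add)
    also have "\<dots> \<le> cap I i * \<phi> h i * (1 + ?a i / (\<gamma> * cap I i) * (1 + \<epsilon> - 1))"
      using with_null_nonneg(1)[OF i assms(2,3)] with_null_le(1)[OF i assms(2,3)]
        cap_pos[OF i] gamma_pos eps_pos phi_nonneg[OF i]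
      by (intro mult_left_mono powr_le_linear) (auto simp: pos_divide_le_eq intro!: divide_nonneg_pos)
    also have "\<dots> = ?r"
      using cap_pos[OF i] gamma_pos by (simp add: field_simps)
    finally show ?thesis .
  qed
  moreover have "(1 - \<epsilon>) powr (total_amount (profit I) i (h @ [(j, k)]) / (\<gamma> * W)) *
      (1 - rate) ^ (m - length h - 1) / (1 - \<epsilon>) powr ((1 - \<epsilon>) / (\<gamma> * (1 + \<epsilon>))) \<le>
      W * \<psi> h i - \<epsilon> / \<gamma> * (?w i * \<psi> h i)" (is "?l \<le> ?r") if i: "i < nres I" for i
  proof -
    have "?l = W * \<psi> h i * (1 - \<epsilon>) powr (?w i / (\<gamma> * W))"
      using W_pos by (simp add: psi_def rate_def[symmetric] add_divide_distrib powr_add)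
    also have "\<dots> \<le> W * \<psi> h i * (1 + ?w i / (\<gamma> * W) * (1 - \<epsilon> - 1))"
      using with_null_nonneg(2)[OF i assms(2,3)] with_null_le(2)[OF i assms(2,3)]
        W_pos gamma_pos eps_less_1 psi_nonneg
      by (intro mult_left_mono powr_le_linear) (auto simp: pos_divide_le_eq intro!: divide_nonneg_pos)
    also have "\<dots> = ?r"
      using W_pos gamma_pos by (simp add: field_simps)
    finally show ?thesis .
  qed
  ultimately have "potential (h @ [(j, k)]) \<le>
      (\<Sum>i<nres I. cap I i * \<phi> h i + \<epsilon> / \<gamma> * (?a i * \<phi> h i)) +
      (\<Sum>i<nres I. W * \<psi> h i - \<epsilon> / \<gamma> * (?w i * \<psi> h i))"
    unfolding potential_def len by (intro add_mono sum_mono) auto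
  also have "\<dots> = (\<Sum>i<nres I. cap I i * \<phi> h i) + (\<Sum>i<nres I. W * \<psi> h i) + \<epsilon> / \<gamma> * \<sigma> h j k"
    by (simp add: score_def sum.distrib sum_subtractf sum_distrib_left right_diff_distrib)
  finally show ?thesis .
qed

text \<open>The expected score contributes at most \<open>rate * (?C - ?P)\<close>, and
  \<open>?C + ?P + rate * (?C - ?P)\<close> is exactly the potential; \<open>rate\<close> is chosen
  for this identity.\<close>

lemma expected_potential_bound_le:
  assumes "length h < m"
  shows "(\<Sum>i<nres I. cap I i * \<phi> h i) + (\<Sum>i<nres I. W * \<psi> h i) +
      \<epsilon> / \<gamma> * measure_pmf.expectation p (\<lambda>j. \<sigma> h j (alg h j)) \<le> potential h"
    (is "?C + ?P + _ * ?E \<le> _")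
proof -
  have "\<epsilon> / \<gamma> * ?E \<le> \<epsilon> / \<gamma> * ((?C - ?P) / ((1 + \<epsilon>) * real m))"
    using expected_score_le[OF assms] eps_pos gamma_pos by (intro mult_left_mono) auto
  also have "\<dots> = rate * (?C - ?P)"
    by (simp add: rate_def)
  finally show ?thesis
    by (simp add: potential_eq[OF assms] algebra_simps)
qed

definition violation :: "history \<Rightarrow> bool" where
  "violation h \<longleftrightarrow> (\<exists>i<nres I. cap I i < total_amount (consumption I) i h \<or>
     total_amount (profit I) i h < W * (1 - 2 * \<epsilon>))"

text \<open>With no requests left the powers of \<open>1 + rate\<close> and \<open>1 - rate\<close>
  are 1, so the summand of the violated constraint alone reaches 1.\<close>

lemma one_le_potential:
  assumes "length h = m" "violation h"
  shows "1 \<le> potential h"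
proof -
  let ?F = "\<lambda>i. (1 + \<epsilon>) powr (total_amount (consumption I) i h / (\<gamma> * cap I i)) *
        (1 + rate) ^ (m - length h) / (1 + \<epsilon>) powr (1 / \<gamma>)"
  let ?G = "\<lambda>i. (1 - \<epsilon>) powr (total_amount (profit I) i h / (\<gamma> * W)) *
        (1 - rate) ^ (m - length h) / (1 - \<epsilon>) powr ((1 - \<epsilon>) / (\<gamma> * (1 + \<epsilon>)))"
  have nonneg: "0 \<le> sum ?F {..<nres I}" "0 \<le> sum ?G {..<nres I}"
    by (intro sum_nonneg potential_summands_nonneg)+
  obtain i where i: "i < nres I" and
    "cap I i < total_amount (consumption I) i h \<or> total_amount (profit I) i h < W * (1 - 2 * \<epsilon>)"
    using assms(2) by (auto simp: violation_def)
  then show ?thesis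
  proof (elim disjE)
    assume "cap I i < total_amount (consumption I) i h"
    then have "1 / \<gamma> \<le> total_amount (consumption I) i h / (\<gamma> * cap I i)"
      using cap_pos[OF i] gamma_pos by (simp add: field_simps)
    then have "(1 + \<epsilon>) powr (1 / \<gamma>) \<le> (1 + \<epsilon>) powr (total_amount (consumption I) i h / (\<gamma> * cap I i))"
      using eps_pos by (intro powr_mono) auto
    then have "1 \<le> ?F i"
      using assms(1) eps_pos by simp
    also have "\<dots> \<le> sum ?F {..<nres I}"
      using i by (intro member_le_sum potential_summands_nonneg) auto
    finally show ?thesis
      using nonneg(2) unfolding potential_def by linarith
  next
    assume less: "total_amount (profit I) i h < W * (1 - 2 * \<epsilon>)"
    \<comment> \<open>The potential normalises profits at
      \<open>W * (1 - \<epsilon>) / (1 + \<epsilon>)\<close>, which is at least the target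
      \<open>W * (1 - 2 * \<epsilon>)\<close>.\<close>
    have "(1 - 2 * \<epsilon>) * (1 + \<epsilon>) \<le> 1 - \<epsilon>"
      by (simp add: algebra_simps)
    then have "1 - 2 * \<epsilon> \<le> (1 - \<epsilon>) / (1 + \<epsilon>)"
      using eps_pos by (simp add: pos_le_divide_eq)
    then have "W * (1 - 2 * \<epsilon>) \<le> W * ((1 - \<epsilon>) / (1 + \<epsilon>))"
      using W_pos by (intro mult_left_mono) auto
    with less have "total_amount (profit I) i h \<le> W * ((1 - \<epsilon>) / (1 + \<epsilon>))"
      by linarith
    then have "total_amount (profit I) i h / (\<gamma> * W) \<le> W * ((1 - \<epsilon>) / (1 + \<epsilon>)) / (\<gamma> * W)"
      using W_pos gamma_pos by (intro divide_right_mono) auto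
    also have "\<dots> = (1 - \<epsilon>) / (\<gamma> * (1 + \<epsilon>))"
      using W_pos by simp
    finally have "(1 - \<epsilon>) powr ((1 - \<epsilon>) / (\<gamma> * (1 + \<epsilon>))) \<le>
        (1 - \<epsilon>) powr (total_amount (profit I) i h / (\<gamma> * W))"
      using eps_pos eps_less_1 by (intro powr_mono') auto
    then have "1 \<le> ?G i"
      using assms(1) eps_less_1 by simp
    also have "\<dots> \<le> sum ?G {..<nres I}"
      using i by (intro member_le_sum potential_summands_nonneg) auto
    finally show ?thesis
      using nonneg(1) unfolding potential_def by linarith
  qed
qed

text \<open>Induction on the number of requests to come, over arbitrary histories: condition on the
  next request, apply the induction hypothesis to the extended history, and average.\<close>

lemma prob_violation_le_potential:
  assumes "length h + n = m"
  shows "measure_pmf.prob (replicate_pmf n p)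
    {js. violation (foldl (\<lambda>h j. h @ [(j, alg h j)]) h js)} \<le> potential h"
  using assms
proof (induction n arbitrary: h)
  case 0
  have "0 \<le> potential h"
    unfolding potential_def by (intro add_nonneg_nonneg sum_nonneg potential_summands_nonneg)
  with 0 show ?case
    using one_le_potential[of h] by (simp add: measure_return_pmf indicator_def)
next
  case (Suc n)
  let ?run = "foldl (\<lambda>h j. h @ [(j, alg h j)])"
  let ?q = "\<lambda>j. measure_pmf.prob (replicate_pmf n p) {js. violation (?run (h @ [(j, alg h j)]) js)}"
  let ?D = "(\<Sum>i<nres I. cap I i * \<phi> h i) + (\<Sum>i<nres I. W * \<psi> h i)"
  have len: "length h < m"
    using Suc.prems by simp
  \<comment> \<open>Averaging this affine bound instead of the next potential needs only
    integrability of the score.\<close>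
  have q: "?q j \<le> ?D + \<epsilon> / \<gamma> * \<sigma> h j (alg h j)" if "j \<in> reqs I" for j
    using Suc.IH[of "h @ [(j, alg h j)]"] Suc.prems
      potential_snoc_le[OF len that algorithm1_option(1)[OF alg len that]] by simp
  have "measure_pmf.prob (replicate_pmf (Suc n) p) {js. violation (?run h js)} =
      measure_pmf.expectation p ?q"
    by (simp add: map_pmf_def[symmetric] measure_bind_pmf vimage_def)
  also have "\<dots> \<le> measure_pmf.expectation p (\<lambda>j. ?D + \<epsilon> / \<gamma> * \<sigma> h j (alg h j))"
  proof (rule integral_mono_AE)
    show "integrable (measure_pmf p) ?q"
      by (rule measure_pmf.integrable_const_bound[where B = 1]) auto
  qed (use q support integrable_score[OF len] in \<open>auto simp: AE_measure_pmf_iff\<close>)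
  also have "\<dots> = ?D + \<epsilon> / \<gamma> * measure_pmf.expectation p (\<lambda>j. \<sigma> h j (alg h j))"
    using integrable_score[OF len] by (subst Bochner_Integration.integral_add) auto
  also have "\<dots> \<le> potential h"
    by (rule expected_potential_bound_le[OF len])
  finally show ?case .
qed

section \<open>Size of the initial potential\<close>

text \<open>From \<open>1 + x \<le> exp x\<close> for \<open>x\<close> equal to \<open>rate\<close>
  and \<open>- rate\<close>; \<open>m\<close> cancels in \<open>rate * real m\<close>. The two
  logarithmic inequalities then bound the exponents.\<close>

lemma potential_Nil_le: "potential [] \<le> 2 * real (nres I) * exp (- \<epsilon>\<^sup>2 / (8 * \<gamma>))"
proof -
  have "(1 + rate) ^ m \<le> exp rate ^ m"
    using rate_pos by (intro power_mono) auto
  also have rate_m: "rate * real m = \<epsilon> / ((1 + \<epsilon>) * \<gamma>)"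
    using m_pos by (simp add: rate_def)
  then have "exp rate ^ m = exp (\<epsilon> / ((1 + \<epsilon>) * \<gamma>))"
    by (simp add: exp_of_nat2_mult[symmetric])
  finally have "(1 + rate) ^ m / (1 + \<epsilon>) powr (1 / \<gamma>) \<le>
      exp (\<epsilon> / ((1 + \<epsilon>) * \<gamma>)) / (1 + \<epsilon>) powr (1 / \<gamma>)"
    by (intro divide_right_mono) auto
  also have "\<dots> = exp (- (ln (1 + \<epsilon>) - \<epsilon> / (1 + \<epsilon>)) / \<gamma>)"
    using eps_pos by (simp add: powr_def exp_diff[symmetric] diff_divide_distrib)
  also have "\<dots> \<le> exp (- (\<epsilon>\<^sup>2 / 8) / \<gamma>)"
    using ln_one_plus_minus_fraction_ge[of \<epsilon>] eps_pos eps_less_1 gamma_pos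
    by (intro iffD2[OF exp_le_cancel_iff] divide_right_mono) auto
  finally have 1: "(1 + rate) ^ m / (1 + \<epsilon>) powr (1 / \<gamma>) \<le> exp (- \<epsilon>\<^sup>2 / (8 * \<gamma>))"
    by simp
  have "(1 - rate) ^ m \<le> exp (- rate) ^ m"
    using rate_less_1 exp_ge_add_one_self[of "- rate"] by (intro power_mono) auto
  also have "\<dots> = exp (- (\<epsilon> / ((1 + \<epsilon>) * \<gamma>)))"
    using rate_m by (simp add: exp_of_nat2_mult[symmetric])
  finally have "(1 - rate) ^ m / (1 - \<epsilon>) powr ((1 - \<epsilon>) / (\<gamma> * (1 + \<epsilon>))) \<le>
      exp (- (\<epsilon> / ((1 + \<epsilon>) * \<gamma>))) / (1 - \<epsilon>) powr ((1 - \<epsilon>) / (\<gamma> * (1 + \<epsilon>)))"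
    by (intro divide_right_mono) auto
  also have "\<dots> = exp (- (\<epsilon> / ((1 + \<epsilon>) * \<gamma>)) - (1 - \<epsilon>) / (\<gamma> * (1 + \<epsilon>)) * ln (1 - \<epsilon>))"
    using eps_less_1 by (simp add: powr_def exp_diff)
  also have "\<dots> = exp (- (\<epsilon> + (1 - \<epsilon>) * ln (1 - \<epsilon>)) / ((1 + \<epsilon>) * \<gamma>))"
  proof -
    have "- (a / d) - b / d' * l = - (a + b * l) / d" if "d' = d" for a b d d' l :: real
      using that by (simp add: diff_divide_distrib add_divide_distrib)
    from this[OF mult.commute] show ?thesis
      by (rule arg_cong)
  qed
  also have "\<dots> \<le> exp (- \<epsilon>\<^sup>2 / (8 * \<gamma>))"
  proof -
    \<comment> \<open>Here \<open>4 * \<gamma>\<close> would do, by \<open>\<epsilon> < 1\<close>;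
      the 8 matches the capacity terms.\<close>
    have "\<epsilon>\<^sup>2 / (8 * \<gamma>) \<le> \<epsilon>\<^sup>2 / ((1 + \<epsilon>) * (2 * \<gamma>))"
      using eps_pos eps_less_1 gamma_pos by (intro divide_left_mono) auto
    also have "\<dots> = (\<epsilon>\<^sup>2 / 2) / ((1 + \<epsilon>) * \<gamma>)"
      by simp
    also have "\<dots> \<le> (\<epsilon> + (1 - \<epsilon>) * ln (1 - \<epsilon>)) / ((1 + \<epsilon>) * \<gamma>)"
      using one_minus_mult_ln_ge[of \<epsilon>] eps_pos eps_less_1 gamma_pos
      by (intro divide_right_mono) auto
    finally show ?thesis
      by (simp only: exp_le_cancel_iff minus_divide_left[symmetric] neg_le_iff_le)
  qed
  finally have 2: "(1 - rate) ^ m / (1 - \<epsilon>) powr ((1 - \<epsilon>) / (\<gamma> * (1 + \<epsilon>))) \<le> exp (- \<epsilon>\<^sup>2 / (8 * \<gamma>))" .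
  have "potential [] = real (nres I) * ((1 + rate) ^ m / (1 + \<epsilon>) powr (1 / \<gamma>)) +
      real (nres I) * ((1 - rate) ^ m / (1 - \<epsilon>) powr ((1 - \<epsilon>) / (\<gamma> * (1 + \<epsilon>))))"
    using eps_pos eps_less_1 by (simp add: potential_def)
  also have "\<dots> \<le> real (nres I) * exp (- \<epsilon>\<^sup>2 / (8 * \<gamma>)) + real (nres I) * exp (- \<epsilon>\<^sup>2 / (8 * \<gamma>))"
    using 1 2 by (intro add_mono mult_left_mono) auto
  finally show ?thesis by simp
qed

text \<open>The constant 1/16 makes the exponent at least
  \<open>2 * ln (nres I / \<epsilon>)\<close>, so each of the \<open>2 * nres I\<close> terms is at
  most \<open>(\<epsilon> / nres I)\<^sup>2\<close>.\<close>

lemma potential_Nil_le_eps: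
  assumes "nres I = 1 \<longrightarrow> \<epsilon> \<le> 1 / 2"
    and "\<gamma> \<le> 1 / 16 * \<epsilon>\<^sup>2 / ln (real (nres I) / \<epsilon>)"
  shows "potential [] \<le> \<epsilon>"
proof -
  \<comment> \<open>One resource: the assumption \<open>\<epsilon> \<le> 1 / 2\<close>. Several:
    \<open>\<epsilon> < 1\<close>.\<close>
  have half: "2 * \<epsilon> \<le> real (nres I)"
    using assms(1) nres_pos eps_less_1 by (cases "nres I = 1") auto
  then have "\<epsilon> < real (nres I)"
    using eps_pos by linarith
  then have ln_pos: "0 < ln (real (nres I) / \<epsilon>)"
    using eps_pos by simp
  then have "2 * ln (real (nres I) / \<epsilon>) \<le> \<epsilon>\<^sup>2 / (8 * \<gamma>)"
    using assms(2) gamma_pos by (simp add: field_simps)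
  then have "exp (- \<epsilon>\<^sup>2 / (8 * \<gamma>)) \<le> exp (- (2 * ln (real (nres I) / \<epsilon>)))"
    by simp
  also have "\<dots> = (\<epsilon> / real (nres I))\<^sup>2"
    using eps_pos nres_pos by (simp add: exp_minus exp_double power_divide)
  finally have "potential [] \<le> 2 * real (nres I) * (\<epsilon> / real (nres I))\<^sup>2"
    using potential_Nil_le by (smt (verit) mult_left_mono of_nat_0_le_iff)
  also have "\<dots> = (2 * \<epsilon> / real (nres I)) * \<epsilon>"
    using nres_pos by (simp add: power2_eq_square)
  also have "\<dots> \<le> 1 * \<epsilon>"
    using half nres_pos eps_pos by (intro mult_right_mono) auto
  finally show ?thesis by simp
qed

end

text \<open>\<open>alg\<close> is fixed before \<open>p\<close> and tied to it only through the
  numbers \<open>W\<close> and \<open>\<gamma>\<close>, which expresses that the distribution is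
  otherwise unknown. For one resource, \<open>\<epsilon> \<le> 1 / 2\<close> keeps the logarithm
  away from 0.\<close>

theorem theorem6:
  shows "\<exists>c>0::real. \<forall>(I::rap) (m::nat) (\<epsilon>::real) (W::real) (\<gamma>::real) alg.
    valid_rap I \<longrightarrow> 0 < \<epsilon> \<longrightarrow> (nres I = 1 \<longrightarrow> \<epsilon> \<le> 1 / 2) \<longrightarrow>
    is_algorithm1 I m \<gamma> W \<epsilon> alg \<longrightarrow>
    (\<forall>p::nat pmf.
       set_pmf p \<subseteq> reqs I \<longrightarrow>
       W = W_E I m p \<longrightarrow>
       \<gamma> = gamma_of I W \<longrightarrow>
       \<gamma> \<le> c * \<epsilon>\<^sup>2 / ln (real (nres I) / \<epsilon>) \<longrightarrow>
       measure_pmf.prob (replicate_pmf m p)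
         {js. (\<forall>i<nres I. total_amount (consumption I) i (run alg js) \<le> cap I i) \<and>
              (\<forall>i<nres I. total_amount (profit I) i (run alg js) \<ge> W * (1 - 2 * \<epsilon>))}
       \<ge> 1 - \<epsilon>)"
proof (intro exI[of _ "1 / 16"] conjI allI impI)
  fix I m \<epsilon> W \<gamma> alg and p :: "nat pmf"
  assume valid: "valid_rap I" and eps: "0 < \<epsilon>" "nres I = 1 \<longrightarrow> \<epsilon> \<le> 1 / 2"
    and alg: "is_algorithm1 I m \<gamma> W \<epsilon> alg" and supp: "set_pmf p \<subseteq> reqs I"
    and W: "W = W_E I m p" and \<gamma>: "\<gamma> = gamma_of I W"
    and gamma_le: "\<gamma> \<le> 1 / 16 * \<epsilon>\<^sup>2 / ln (real (nres I) / \<epsilon>)"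
  let ?good = "{js. (\<forall>i<nres I. total_amount (consumption I) i (run alg js) \<le> cap I i) \<and>
              (\<forall>i<nres I. total_amount (profit I) i (run alg js) \<ge> W * (1 - 2 * \<epsilon>))}"
  interpret random_instance I m p
    by unfold_locales (fact valid supp)+
  \<comment> \<open>For \<open>1 \<le> \<epsilon>\<close> the claimed bound is nonpositive; for
    \<open>W = 0\<close> every run in the support is good; the potential handles the rest.\<close>
  consider "1 \<le> \<epsilon>" | "W = 0" | "\<epsilon> < 1" "0 < W"
    using W_E_nonneg W by fastforce
  then show "1 - \<epsilon> \<le> measure_pmf.prob (replicate_pmf m p) ?good"
  proof cases
    case 1
    then show ?thesis
      by (intro order_trans[OF _ measure_nonneg]) simp
  next
    case 2
    have "js \<in> ?good" if "js \<in> set_pmf (replicate_pmf m p)" for js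
    proof -
      have "length js \<le> m" "set js \<subseteq> reqs I"
        using that supp by (auto simp: set_replicate_pmf)
      then show ?thesis
        using run_if_W_E_zero[of \<epsilon> alg _ js] 2 alg eps W \<gamma> cap_pos by (auto simp: less_imp_le)
    qed
    then have "measure_pmf.prob (replicate_pmf m p) ?good = 1"
      by (subst measure_pmf.prob_eq_1) (auto simp: AE_measure_pmf_iff)
    with eps show ?thesis by simp
  next
    case 3
    interpret algorithm1_run I m p \<epsilon> alg
      using 3 eps alg W \<gamma> by unfold_locales auto
    have "measure_pmf.prob (replicate_pmf m p) {js. violation (run alg js)} \<le> potential []"
      unfolding run_def by (rule prob_violation_le_potential) simp
    also have "\<dots> \<le> \<epsilon>"
      using eps gamma_le W \<gamma> by (intro potential_Nil_le_eps) auto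
    finally have "measure_pmf.prob (replicate_pmf m p) {js. violation (run alg js)} \<le> \<epsilon>" .
    moreover have "{js. violation (run alg js)} = space (measure_pmf (replicate_pmf m p)) - ?good"
      using W by (auto simp: violation_def not_less not_le)
    ultimately show ?thesis
      using measure_pmf.prob_compl[of ?good "replicate_pmf m p"] by simp
  qed
qed simp

end
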